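(* Let $\lambda:\mathbb{Z}\to\mathbb{C}$ and $w:\mathbb{Z}\to\mathbb{C}\setminus\{0\}$ be such that $$\sum_{n=-\infty}^{\infty}\left|\frac{w_n^2}{(\lambda_n-z_0)(\lambda_{n+1}-z_0)}\right|<\infty$$ for at least one $z_0\in\mathbb{C}_0^\lambda$. Then $$\mathfrak Z(\mathcal J)\subset\operatorname{spec}_p(J_{\max})\setminus\operatorname{der}(\lambda)$$ and, for $z\in\mathfrak Z(\mathcal J)$, the corresponding eigenvector of $J_{\max}$ can be chosen as $f(z)$.
   Context: Formal matrix: for $\lambda:\mathbb{Z}\to\mathbb{C}$, $w:\mathbb{Z}\to\mathbb{C}\setminus\{0\}$, the doubly infinite symmetric tridiagonal (Jacobi) matrix $\mathcal J$ acts on all complex sequences $x=(x_n)_{n\in\mathbb{Z}}$ by $(\mathcal Jx)_n=w_{n-1}x_{n-1}+\lambda_nx_n+w_nx_{n+1}$, $n\in\mathbb{Z}$. The operator $J_{\max}$ on $\ell^2(\mathbb{Z})$ has domain $\{x\in\ell^2(\mathbb{Z})\mid\mathcal Jx\in\ell^2(\mathbb{Z})\}$ and acts by $J_{\max}x=\mathcal Jx$. $\operatorname{spec}_p$ denotes the point spectrum (set of eigenvalues). Sets: $\operatorname{Ran}(\lambda)=\{\lambda_n\mid n\in\mathbb{Z}\}$; $\mathbb{C}_0^\lambda=\mathbb{C}\setminus\overline{\operatorname{Ran}(\lambda)}$; $\operatorname{der}(\lambda)$ is the set of all finite limit points of $\lambda$, i.e. of all limits of convergent subsequences $(\lambda_{n_k})_k$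 with pairwise distinct indices $n_k$. For $z\in\mathbb{C}$: $r(z):=\#\{n\in\mathbb{Z}\mid\lambda_n=z\}$, $r_+(z):=\#\{n>0\mid\lambda_n=z\}$. Function $\mathfrak F$: for a complex sequence with $\sum_{k\in\mathbb{Z}}|x_kx_{k+1}|<\infty$, $$\mathfrak F(\{x_k\}_{k=-\infty}^{\infty}):=1+\sum_{m=1}^\infty(-1)^m\sum_{k_1=-\infty}^{\infty}\ \sum_{k_2=k_1+2}^{\infty}\cdots\sum_{k_m=k_{m-1}+2}^{\infty}\ \prod_{j=1}^m x_{k_j}x_{k_j+1}.$$ For a one-sided sequence, $\mathfrak F(\{x_k\}_{k=n}^{\infty})$ is defined by setting the missing $x_k:=0$. Characteristic function: $\gamma:\mathbb{Z}\to\mathbb{C}$ is any sequence with $\gamma_n\gamma_{n+1}=w_n$ for all $n$. If the summability condition holds for one $z_0\in\mathbb{C}_0^\lambda$ it holds for all, and $F_{\mathcal J}(z):=\mathfrak F\left(\left\{\frac{\gamma_n^2}{z-\lambda_n}\right\}_{n=-\infty}^\infty\right)$ for $z\in\mathbb{C}_0^\lambda$, independent of the choice of $\gamma$. It is analytic on $\mathbb{C}_0^\lambda$ and meromorphic on $\mathbb{C}\setminus\operatorname{der}(\lambda)$, with at each $z\in\operatorname{Ran}(\lambda)\setminus\operatorname{der}(\lambda)$ a removable singularity or a pole of order at most $r(z)$. Extended zero set: $\mathfrak Z(\mathcal J):=\{z\in\mathbb{C}\setminus\operatorname{der}(\lambda)\mid\lim_{u\to z}(u-z)^{r(z)}F_{\mathcal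 J}(u)=0\}$. The sequence $f(z)$: for $z\in\mathbb{C}_0^\lambda$ and $n\in\mathbb{Z}$, $f_n(z):=\mathcal P_n(z)\,\mathfrak F\left(\left\{\frac{\gamma_k^2}{\lambda_k-z}\right\}_{k=n+1}^{\infty}\right)$, where $\mathcal P_n(z):=\prod_{k=1}^n\frac{w_{k-1}}{z-\lambda_k}$ if $n\ge0$ and $\mathcal P_n(z):=\prod_{k=n+1}^0\frac{z-\lambda_k}{w_{k-1}}$ if $n<0$. For $z\in\operatorname{Ran}(\lambda)\setminus\operatorname{der}(\lambda)$, $f_n(z):=\lim_{u\to z}(u-z)^{r_+(z)}f_n(u)$. *)

theory Defs
  imports "HOL-Analysis.Analysis"
begin

definition ell2 :: "(int \<Rightarrow> complex) set" where
  "ell2 = {x. (\<lambda>n. (cmod (x n))\<^sup>2) summable_on UNIV}"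

definition jacobi_matrix ::
    "(int \<Rightarrow> complex) \<Rightarrow> (int \<Rightarrow> complex) \<Rightarrow> (int \<Rightarrow> complex) \<Rightarrow> int \<Rightarrow> complex" where
  "jacobi_matrix lam w x n = w (n - 1) * x (n - 1) + lam n * x n + w n * x (n + 1)"

text \<open>An operator is given by its domain \<open>D\<close> and its action \<open>T\<close>, which is only meaningful
  on \<open>D\<close>. The maximal operator \<open>J\<^sub>m\<^sub>a\<^sub>x\<close> has domain \<open>Jmax_dom lam w\<close> and action
  \<open>jacobi_matrix lam w\<close>.\<close>

definition Jmax_dom :: "(int \<Rightarrow> complex) \<Rightarrow> (int \<Rightarrow> complex) \<Rightarrow> (int \<Rightarrow> complex) set" where
  "Jmax_dom lam w = {x \<in> ell2. jacobi_matrix lam w x \<in> ell2}"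

definition eigenvector ::
    "(int \<Rightarrow> complex) set \<Rightarrow> ((int \<Rightarrow> complex) \<Rightarrow> int \<Rightarrow> complex) \<Rightarrow> complex
      \<Rightarrow> (int \<Rightarrow> complex) \<Rightarrow> bool" where
  "eigenvector D T z x \<longleftrightarrow> x \<in> D \<and> x \<noteq> (\<lambda>n. 0) \<and> T x = (\<lambda>n. z * x n)"

definition point_spectrum ::
    "(int \<Rightarrow> complex) set \<Rightarrow> ((int \<Rightarrow> complex) \<Rightarrow> int \<Rightarrow> complex) \<Rightarrow> complex set" where
  "point_spectrum D T = {z. \<exists>x. eigenvector D T z x}"

definition C0 :: "(int \<Rightarrow> complex) \<Rightarrow> complex set" where
  "C0 lam = - closure (range lam)"

definition der :: "(int \<Rightarrow> complex) \<Rightarrow> complex set" where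
  "der lam = {z. \<exists>k :: nat \<Rightarrow> int. inj k \<and> (\<lambda>i. lam (k i)) \<longlonglongrightarrow> z}"

text \<open>If \<open>lam\<close> takes the value \<open>z\<close> infinitely often, then \<open>z \<in> der lam\<close>. The two counting
  functions below are only used outside \<open>der lam\<close>, where the sets are finite.\<close>

definition r_all :: "(int \<Rightarrow> complex) \<Rightarrow> complex \<Rightarrow> nat" where
  "r_all lam z = card {n. lam n = z}"

definition r_plus :: "(int \<Rightarrow> complex) \<Rightarrow> complex \<Rightarrow> nat" where
  "r_plus lam z = card {n. n > 0 \<and> lam n = z}"

text \<open>\<open>nested_sum x m A\<close> is the iterated sum of
  \<open>\<Prod>j=1..m. x k\<^sub>j * x (k\<^sub>j + 1)\<close> over \<open>k\<^sub>1 \<in> A\<close>, \<open>k\<^sub>2 \<ge> k\<^sub>1 + 2\<close>, \<dots>,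
  \<open>k\<^sub>m \<ge> k\<^sub>m\<^sub>-\<^sub>1 + 2\<close>.\<close>

primrec nested_sum :: "(int \<Rightarrow> complex) \<Rightarrow> nat \<Rightarrow> int set \<Rightarrow> complex" where
  "nested_sum x 0 A = 1"
| "nested_sum x (Suc m) A = (\<Sum>\<^sub>\<infinity>k\<in>A. x k * x (k + 1) * nested_sum x m {k + 2..})"

definition FF :: "(int \<Rightarrow> complex) \<Rightarrow> complex" where
  "FF x = 1 + (\<Sum>m. (- 1) ^ Suc m * nested_sum x (Suc m) UNIV)"

definition FF_from :: "int \<Rightarrow> (int \<Rightarrow> complex) \<Rightarrow> complex" where
  "FF_from n x = FF (\<lambda>k. if k < n then 0 else x k)"

definition char_fun :: "(int \<Rightarrow> complex) \<Rightarrow> (int \<Rightarrow> complex) \<Rightarrow> complex \<Rightarrow> complex" where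
  "char_fun lam \<gamma> z = FF (\<lambda>n. (\<gamma> n)\<^sup>2 / (z - lam n))"

text \<open>For \<open>z \<notin> der lam\<close>, a punctured neighbourhood of \<open>z\<close> is contained in \<open>C0 lam\<close>, so the limits
  at \<open>z\<close> below involve only values at points of \<open>C0 lam\<close>.\<close>

definition zero_set :: "(int \<Rightarrow> complex) \<Rightarrow> (int \<Rightarrow> complex) \<Rightarrow> complex set" where
  "zero_set lam \<gamma> = {z. z \<notin> der lam \<and>
     ((\<lambda>u. (u - z) ^ r_all lam z * char_fun lam \<gamma> u) \<longlongrightarrow> 0) (at z)}"

definition PP :: "(int \<Rightarrow> complex) \<Rightarrow> (int \<Rightarrow> complex) \<Rightarrow> complex \<Rightarrow> int \<Rightarrow> complex" where
  "PP lam w z n =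
     (if n \<ge> 0 then \<Prod>k\<in>{1..n}. w (k - 1) / (z - lam k)
      else \<Prod>k\<in>{n + 1..0}. (z - lam k) / w (k - 1))"

definition f_regular ::
    "(int \<Rightarrow> complex) \<Rightarrow> (int \<Rightarrow> complex) \<Rightarrow> (int \<Rightarrow> complex) \<Rightarrow> complex \<Rightarrow> int \<Rightarrow> complex" where
  "f_regular lam w \<gamma> z n = PP lam w z n * FF_from (n + 1) (\<lambda>k. (\<gamma> k)\<^sup>2 / (lam k - z))"

text \<open>The second branch is meant for \<open>z \<in> range lam - der lam\<close>, which is the complement of
  \<open>C0 lam\<close> in \<open>- der lam\<close>.\<close>

definition f_seq ::
    "(int \<Rightarrow> complex) \<Rightarrow> (int \<Rightarrow> complex) \<Rightarrow> (int \<Rightarrow> complex) \<Rightarrow> complex \<Rightarrow> int \<Rightarrow> complex" where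
  "f_seq lam w \<gamma> z n =
     (if z \<in> C0 lam then f_regular lam w \<gamma> z n
      else Lim (at z) (\<lambda>u. (u - z) ^ r_plus lam z * f_regular lam w \<gamma> u n))"

text \<open>A sequence \<open>\<gamma>\<close> as required in the construction of the characteristic function always exists.\<close>

lemma gamma_exists:
  fixes w :: "int \<Rightarrow> complex"
  assumes "\<forall>n. w n \<noteq> 0"
  shows "\<exists>\<gamma>. \<forall>n. \<gamma> n * \<gamma> (n + 1) = w n"
proof -
  define a where "a = rec_nat 1 (\<lambda>k y. w (int k) / y)"
  define b where "b = rec_nat 1 (\<lambda>k y. w (- int k - 1) / y)"
  have a: "a 0 = 1" "\<And>k. a (Suc k) = w (int k) / a k" by (simp_all add: a_def)
  have b: "b 0 = 1" "\<And>k. b (Suc k) = w (- int k - 1) / b k" by (simp_all add: b_def)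
  have a0: "a k \<noteq> 0" for k by (induction k) (use assms in \<open>simp_all add: a\<close>)
  have b0: "b k \<noteq> 0" for k by (induction k) (use assms in \<open>simp_all add: b\<close>)
  define g where "g n = (if n \<ge> 0 then a (nat n) else b (nat (- n)))" for n
  have "g n * g (n + 1) = w n" for n
  proof (cases "n \<ge> 0")
    case True
    then have "nat (n + 1) = Suc (nat n)" by simp
    then show ?thesis using True a0 by (simp add: g_def a)
  next
    case False
    define k where "k = nat (- n - 1)"
    have n: "n = - int k - 1" using False by (simp add: k_def)
    have "g n = b (Suc k)" by (simp add: g_def n nat_add_distrib)
    moreover have "g (n + 1) = b k" by (cases k) (simp_all add: g_def n a b(1) nat_add_distrib)
    ultimately show ?thesis using b0[of k] by (simp add: b n)
  qed
  then show ?thesis by blast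
qed

end

theory Submission
  imports Defs
begin

text \<open>
  With \<open>x\<^sub>k = \<gamma>\<^sub>k\<^sup>2 / (\<lambda>\<^sub>k - z)\<close>, the tails \<open>\<phi>\<^sub>n\<close> of \<open>FF x\<close> from index \<open>n\<close> on satisfy
  \<open>\<phi>\<^sub>n = \<phi>\<^sub>n\<^sub>+\<^sub>1 - x\<^sub>n x\<^sub>n\<^sub>+\<^sub>1 \<phi>\<^sub>n\<^sub>+\<^sub>2\<close> and tend to \<open>1\<close> at \<open>+\<infinity>\<close>. This makes \<open>f(z)\<close> a solution of the
  eigenvalue equation which is square summable at \<open>+\<infinity>\<close>. The index reflection \<open>n \<mapsto> -n\<close> turns the
  same construction into a solution that is square summable at \<open>-\<infinity>\<close>, and the Wronskian of the two
  is \<open>(\<lambda>\<^sub>0 - z) F\<^sub>J(z)\<close>. At a zero of the characteristic function the two solutions are therefore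
  proportional, and both are square summable. If \<open>z\<close> is one of the \<open>\<lambda>\<^sub>n\<close>, both solutions are
  multiplied by powers of \<open>u - z\<close> and one passes to the limit \<open>u \<rightarrow> z\<close>; the limits exist for large
  indices by dominated convergence and for all others by running the three-term recurrence backwards.
\<close>

subsection \<open>The function \<open>FF\<close>\<close>


text \<open>Dominated convergence for unordered sums along any filter: the common majorant makes the
  finite partial sums converge uniformly (Weierstrass M-test), so the two limits may be
  exchanged.\<close>

lemma tendsto_infsum_dominated:
  fixes f :: "'i \<Rightarrow> 'a \<Rightarrow> 'b :: banach"
  assumes lim: "\<And>k. k \<in> A \<Longrightarrow> ((\<lambda>i. f i k) \<longlongrightarrow> g k) F"
    and le: "\<forall>\<^sub>F i in F. \<forall>k\<in>A. norm (f i k) \<le> M k"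
    and M: "M summable_on A"
  shows "((\<lambda>i. infsum (f i) A) \<longlongrightarrow> infsum g A) F"
proof (cases "F = bot")
  case False
  have g: "norm (g k) \<le> M k" if "k \<in> A" for k
  proof (rule tendsto_upperbound[OF tendsto_norm[OF lim[OF that]] _ False])
    show "\<forall>\<^sub>F i in F. norm (f i k) \<le> M k"
      using le that by (auto elim: eventually_mono)
  qed
  have "(\<lambda>k. norm (g k)) summable_on A"
    by (rule summable_on_comparison_test[OF M g]) auto
  then have gs: "g summable_on A"
    by (rule abs_summable_summable)
  show ?thesis
  proof (rule swap_uniform_limit')
    show "\<forall>\<^sub>F K in finite_subsets_at_top A. ((\<lambda>i. sum (f i) K) \<longlongrightarrow> sum g K) F"
      by (rule eventually_finite_subsets_at_top_weakI) (auto intro!: tendsto_sum lim)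
    show "(sum g \<longlongrightarrow> infsum g A) (finite_subsets_at_top A)"
      by (rule infsum_tendsto[OF gs])
    show "\<forall>\<^sub>F i in F. i \<in> {i. \<forall>k\<in>A. norm (f i k) \<le> M k}"
      using le by simp
    show "uniform_limit {i. \<forall>k\<in>A. norm (f i k) \<le> M k} (\<lambda>K i. sum (f i) K)
        (\<lambda>i. infsum (f i) A) (finite_subsets_at_top A)"
      by (rule Weierstrass_m_test_general[OF _ M]) auto
  qed simp
qed simp

lemma infsum_atLeast_int:
  fixes f :: "int \<Rightarrow> 'a :: banach"
  assumes "f summable_on {n + 1..}"
  shows "infsum f {n..} = f n + infsum f {n + 1..}"
proof -
  have "{n..} = insert n {n + 1..}" by auto
  then show ?thesis using infsum_insert[OF assms, of n] by simp
qed

lemma summable_on_norm_bound: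
  fixes f :: "'a \<Rightarrow> 'b :: banach"
  assumes "g summable_on B" "A \<subseteq> B" "\<And>k. k \<in> A \<Longrightarrow> norm (f k) \<le> g k"
  shows "f summable_on A" "norm (infsum f A) \<le> infsum g A"
proof -
  have g: "g summable_on A" by (rule summable_on_subset[OF assms(1,2)])
  have "(\<lambda>k. norm (f k)) summable_on A"
    by (rule summable_on_comparison_test[OF g assms(3)]) auto
  then show f: "f summable_on A" by (rule abs_summable_summable)
  show "norm (infsum f A) \<le> infsum g A"
    by (rule norm_infsum_le[OF has_sum_infsum[OF f] has_sum_infsum[OF g] assms(3)])
qed

text \<open>With \<open>t\<^sub>k\<close> the tail sum of \<open>B\<close> from \<open>k\<close> on, \<open>2 B\<^sub>k exp (2 t\<^sub>k\<^sub>+\<^sub>1) \<le> exp (2 t\<^sub>k) - exp (2 t\<^sub>k\<^sub>+\<^sub>1)\<close>,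
  so the sum over the outermost index telescopes.\<close>

lemma norm_nested_sum_atLeast:
  assumes B: "B summable_on UNIV"
    and le: "\<And>k. cmod (x k * x (k + 1)) \<le> B k"
  shows "cmod (nested_sum x m {n..}) \<le> exp (2 * infsum B {n..}) / 2 ^ m"
proof (induction m arbitrary: n)
  case 0
  have "0 \<le> infsum B {n..}"
    by (rule infsum_nonneg) (use le norm_ge_zero order_trans in blast)
  then show ?case by simp
next
  case (Suc m)
  define t where "t k = infsum B {k..}" for k
  have B0: "0 \<le> B k" for k using le norm_ge_zero order_trans by blast
  have t: "t k = B k + t (k + 1)" for k
    unfolding t_def by (rule infsum_atLeast_int) (rule summable_on_subset[OF B], simp)
  have step: "B k * exp (2 * t (k + 1)) \<le> exp (2 * t k) / 2 - exp (2 * t (k + 1)) / 2" for k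
  proof -
    have "(1 + 2 * B k) * exp (2 * t (k + 1)) \<le> exp (2 * B k) * exp (2 * t (k + 1))"
      by (intro mult_right_mono exp_ge_add_one_self) auto
    also have "\<dots> = exp (2 * t k)" unfolding t[of k] by (simp add: exp_add[symmetric] algebra_simps)
    finally show ?thesis by (simp add: algebra_simps)
  qed
  \<comment> \<open>Any finite index set lies in an integer interval starting at \<open>n\<close>,
    where \<open>step\<close> telescopes. The bound for all finite sets gives both summability and
    the bound on the infinite sum.\<close>
  have fin: "(\<Sum>k\<in>F. B k * exp (2 * t (k + 1))) \<le> exp (2 * t n) / 2"
    if F: "finite F" "F \<subseteq> {n..}" for F
  proof -
    have tele: "(\<Sum>k\<in>{n..<n + int N}. B k * exp (2 * t (k + 1)))
        \<le> exp (2 * t n) / 2 - exp (2 * t (n + int N)) / 2" for N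
    proof (induction N)
      case (Suc N)
      have "{n..<n + int (Suc N)} = insert (n + int N) {n..<n + int N}" by auto
      then show ?case using Suc step[of "n + int N"] by (simp add: algebra_simps)
    qed simp
    obtain N where N: "F \<subseteq> {n..<n + int N}"
    proof (cases "F = {}")
      case False
      have "F \<subseteq> {n..<n + int (nat (Max F - n + 1))}"
      proof
        fix k assume k: "k \<in> F"
        then have "k \<le> Max F" "n \<le> k" using F by auto
        then show "k \<in> {n..<n + int (nat (Max F - n + 1))}" by simp
      qed
      then show ?thesis by (rule that)
    qed (use that in auto)
    have "(\<Sum>k\<in>F. B k * exp (2 * t (k + 1))) \<le> (\<Sum>k\<in>{n..<n + int N}. B k * exp (2 * t (k + 1)))"
      by (rule sum_mono2[OF _ N]) (auto simp: B0)
    also have "\<dots> \<le> exp (2 * t n) / 2" using tele[of N] by (smt (verit) exp_gt_zero half_gt_zero)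
    finally show ?thesis .
  qed
  have tmono: "t (k + 2) \<le> t (k + 1)" for k using t[of "k + 1"] B0[of "k + 1"] by (simp add: algebra_simps)
  have sm: "(\<lambda>k. B k * exp (2 * t (k + 1))) summable_on {n..}"
  proof (rule nonneg_bdd_above_summable_on)
    show "bdd_above (sum (\<lambda>k. B k * exp (2 * t (k + 1))) ` {F. F \<subseteq> {n..} \<and> finite F})"
      by (rule bdd_aboveI2[of _ _ "exp (2 * t n) / 2"]) (use fin in blast)
  qed (auto simp: B0)
  have "cmod (nested_sum x (Suc m) {n..}) \<le> (\<Sum>\<^sub>\<infinity>k\<in>{n..}. B k * exp (2 * t (k + 1)) * (1 / 2 ^ m))"
    unfolding nested_sum.simps
  proof (rule summable_on_norm_bound(2)[OF summable_on_cmult_left[OF sm] order_refl])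
    fix k
    \<comment> \<open>The induction hypothesis involves the tail from \<open>k + 2\<close>; it is
      enlarged to the tail from \<open>k + 1\<close>, the one that telescopes.\<close>
    have "cmod (x k * x (k + 1) * nested_sum x m {k + 2..}) \<le> B k * (exp (2 * t (k + 2)) / 2 ^ m)"
      unfolding norm_mult[of "x k * x (k + 1)"] t_def by (intro mult_mono le Suc.IH B0 norm_ge_zero)
    also have "\<dots> \<le> B k * (exp (2 * t (k + 1)) / 2 ^ m)"
      by (intro mult_left_mono divide_right_mono B0) (auto simp: tmono)
    finally show "cmod (x k * x (k + 1) * nested_sum x m {k + 2..})
        \<le> B k * exp (2 * t (k + 1)) * (1 / 2 ^ m)" by simp
  qed
  also have "\<dots> = (\<Sum>\<^sub>\<infinity>k\<in>{n..}. B k * exp (2 * t (k + 1))) * (1 / 2 ^ m)"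
    by (rule infsum_cmult_left[OF sm])
  also have "\<dots> \<le> (exp (2 * t n) / 2) * (1 / 2 ^ m)"
    by (intro mult_right_mono infsum_le_finite_sums[OF sm] fin) auto
  finally show ?case by (simp add: t_def)
qed

text \<open>\<open>C\<close> depends on \<open>B\<close> alone and thus serves a whole family of
  sequences, as dominated convergence requires. Since \<open>A\<close> need not be a half-line, the
  outermost sum is estimated directly and only the inner ones by the exponential bound.\<close>

lemma nested_sum_bound:
  assumes B: "B summable_on UNIV"
  obtains C where "\<And>x m A. (\<And>k. cmod (x k * x (k + 1)) \<le> B k)
    \<Longrightarrow> cmod (nested_sum x m A) \<le> C / 2 ^ m"
proof -
  define S where "S = infsum B UNIV"
  \<comment> \<open>The case \<open>m = 0\<close> requires at least \<open>1\<close>, the case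
    \<open>m > 0\<close> at least \<open>2 * S * exp (2 * S)\<close>; this value dominates
    both.\<close>
  define C where "C = (1 + 2 * S) * exp (2 * S)"
  have "cmod (nested_sum x m A) \<le> C / 2 ^ m" if le: "\<And>k. cmod (x k * x (k + 1)) \<le> B k" for x m A
  proof -
    have B0: "0 \<le> B k" for k using le norm_ge_zero order_trans by blast
    have S0: "0 \<le> S" unfolding S_def by (rule infsum_nonneg) (rule B0)
    have BA: "B summable_on A" for A by (rule summable_on_subset[OF B]) simp
    have IS: "infsum B A \<le> S" for A unfolding S_def by (rule infsum_mono2[OF BA B]) (auto simp: B0)
    show ?thesis
    proof (cases m)
      case 0
      have "1 * 1 \<le> C" unfolding C_def by (intro mult_mono) (use S0 in auto)
      then show ?thesis using 0 by simp
    next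
      case (Suc m')
      have "cmod (nested_sum x (Suc m') A) \<le> (\<Sum>\<^sub>\<infinity>k\<in>A. B k * (exp (2 * S) / 2 ^ m'))"
        unfolding nested_sum.simps
      proof (rule summable_on_norm_bound(2)[OF summable_on_cmult_left[OF BA] order_refl])
        fix k
        have "cmod (nested_sum x m' {k + 2..}) \<le> exp (2 * infsum B {k + 2..}) / 2 ^ m'"
          by (rule norm_nested_sum_atLeast[OF B le])
        also have "\<dots> \<le> exp (2 * S) / 2 ^ m'" by (intro divide_right_mono) (auto simp: IS)
        finally show "cmod (x k * x (k + 1) * nested_sum x m' {k + 2..}) \<le> B k * (exp (2 * S) / 2 ^ m')"
          unfolding norm_mult[of "x k * x (k + 1)"] by (intro mult_mono le B0 norm_ge_zero)
      qed
      also have "\<dots> = infsum B A * (exp (2 * S) / 2 ^ m')"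
        by (rule infsum_cmult_left[OF BA])
      also have "\<dots> \<le> S * (exp (2 * S) / 2 ^ m')" by (intro mult_right_mono IS) auto
      also have "\<dots> = (2 * S * exp (2 * S)) / 2 ^ m" by (simp add: Suc)
      also have "\<dots> \<le> C / 2 ^ m" unfolding C_def by (intro divide_right_mono) (auto simp: algebra_simps)
      finally show ?thesis using Suc by simp
    qed
  qed
  then show ?thesis by (rule that)
qed

section \<open>Continuity of \<open>FF\<close> and limits of its tails\<close>

lemma nested_sum_cong:
  assumes "\<And>k. x k * x (k + 1) = y k * y (k + 1)"
  shows "nested_sum x m A = nested_sum y m A"
  by (induction m arbitrary: A) (simp_all add: assms)

text \<open>In particular \<open>FF\<close> is unchanged when all signs flip, which reconciles the
  denominators \<open>z - lam n\<close> of \<open>char_fun\<close> with the \<open>lam k - z\<close>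
  of \<open>f_regular\<close>.\<close>

lemma FF_cong: "(\<And>k. x k * x (k + 1) = y k * y (k + 1)) \<Longrightarrow> FF x = FF y"
  unfolding FF_def by (subst nested_sum_cong[of x y]) auto

lemma nested_sum_tendsto:
  assumes B: "B summable_on UNIV"
    and le: "\<forall>\<^sub>F i in F. \<forall>k. cmod (X i k * X i (k + 1)) \<le> B k"
    and lim: "\<And>k. ((\<lambda>i. X i k * X i (k + 1)) \<longlongrightarrow> x k * x (k + 1)) F"
  shows "((\<lambda>i. nested_sum (X i) m A) \<longlongrightarrow> nested_sum x m A) F"
proof (induction m arbitrary: A)
  case (Suc m)
  obtain C where C: "\<And>x m A. (\<And>k. cmod (x k * x (k + 1)) \<le> B k)
      \<Longrightarrow> cmod (nested_sum x m A) \<le> C / 2 ^ m"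
    using nested_sum_bound[OF B] by blast
  show ?case unfolding nested_sum.simps
  proof (rule tendsto_infsum_dominated)
    show "((\<lambda>i. X i k * X i (k + 1) * nested_sum (X i) m {k + 2..})
        \<longlongrightarrow> x k * x (k + 1) * nested_sum x m {k + 2..}) F" for k
      by (intro tendsto_mult[OF lim Suc])
    show "\<forall>\<^sub>F i in F. \<forall>k\<in>A. cmod (X i k * X i (k + 1) * nested_sum (X i) m {k + 2..}) \<le> B k * (C / 2 ^ m)"
      using le
    proof eventually_elim
      case (elim i)
      have "0 \<le> B k" for k using elim norm_ge_zero order_trans by blast
      then show ?case
        unfolding norm_mult[of "X i k * X i (k + 1)" for k]
        using elim by (intro ballI mult_mono C norm_ge_zero) auto
    qed
    show "(\<lambda>k. B k * (C / 2 ^ m)) summable_on A"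
      by (rule summable_on_cmult_left, rule summable_on_subset[OF B]) simp
  qed
qed simp

text \<open>Tannery's theorem for the series over \<open>m\<close>: each term converges by induction
  on the nesting depth, and \<open>C / 2 ^ m\<close> is a majorant uniform in
  \<open>i\<close>.\<close>

lemma FF_tendsto:
  assumes B: "B summable_on UNIV"
    and le: "\<forall>\<^sub>F i in F. \<forall>k. cmod (X i k * X i (k + 1)) \<le> B k"
    and lim: "\<And>k. ((\<lambda>i. X i k * X i (k + 1)) \<longlongrightarrow> x k * x (k + 1)) F"
  shows "((\<lambda>i. FF (X i)) \<longlongrightarrow> FF x) F"
proof (cases "F = bot")
  case False
  obtain C where C: "\<And>x m A. (\<And>k. cmod (x k * x (k + 1)) \<le> B k)
      \<Longrightarrow> cmod (nested_sum x m A) \<le> C / 2 ^ m"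
    using nested_sum_bound[OF B] by blast
  have "((\<lambda>i. \<Sum>m. (- 1) ^ Suc m * nested_sum (X i) (Suc m) UNIV) \<longlongrightarrow>
      (\<Sum>m. (- 1) ^ Suc m * nested_sum x (Suc m) UNIV)) F"
  proof (rule tannerys_theorem[THEN conjunct2, THEN conjunct2, OF _ _ _ False])
    show "((\<lambda>i. (- 1) ^ Suc m * nested_sum (X i) (Suc m) UNIV) \<longlongrightarrow>
        (- 1) ^ Suc m * nested_sum x (Suc m) UNIV) F" for m
      by (intro tendsto_mult tendsto_const nested_sum_tendsto[OF B le lim])
    show "\<forall>\<^sub>F (m, i) in at_top \<times>\<^sub>F F.
        cmod ((- 1) ^ Suc m * nested_sum (X i) (Suc m) UNIV) \<le> C * (1 / 2) ^ Suc m"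
      unfolding eventually_prod_filter
    proof (intro exI conjI)
      show "\<forall>m i. True \<longrightarrow> (\<forall>k. cmod (X i k * X i (k + 1)) \<le> B k) \<longrightarrow>
          (case (m, i) of (m, i) \<Rightarrow> cmod ((- 1) ^ Suc m * nested_sum (X i) (Suc m) UNIV)
             \<le> C * (1 / 2) ^ Suc m)"
      proof (intro allI impI)
        fix m i assume "\<forall>k. cmod (X i k * X i (k + 1)) \<le> B k"
        then have "cmod (nested_sum (X i) (Suc m) UNIV) \<le> C / 2 ^ Suc m" by (intro C) auto
        then show "case (m, i) of (m, i) \<Rightarrow> cmod ((- 1) ^ Suc m * nested_sum (X i) (Suc m) UNIV)
             \<le> C * (1 / 2) ^ Suc m"
          by (simp only: prod.case norm_mult norm_power norm_minus_cancel norm_one power_one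
              mult_1 power_divide) simp
      qed
    qed (use le in auto)
    show "summable (\<lambda>m. C * (1 / 2) ^ Suc m)"
      by (intro summable_mult summable_ignore_initial_segment[where k = 1, simplified] summable_geometric) simp
  qed
  then show ?thesis unfolding FF_def by (intro tendsto_add tendsto_const)
qed simp

lemma FF_from_cong:
  "(\<And>k. n \<le> k \<Longrightarrow> x k * x (k + 1) = y k * y (k + 1)) \<Longrightarrow> FF_from n x = FF_from n y"
  unfolding FF_from_def by (rule FF_cong) auto

text \<open>Control is required only from \<open>n\<close> on, because near a value of
  \<open>lam\<close> the products with smaller index may blow up. Truncation makes those products
  \<open>0\<close>, which \<open>B \<ge> 0\<close> still dominates.\<close>

lemma FF_from_tendsto:
  assumes "B summable_on UNIV"
    and "\<forall>\<^sub>F i in F. \<forall>k\<ge>n. cmod (X i k * X i (k + 1)) \<le> B k"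
    and "\<And>k. 0 \<le> B k"
    and "\<And>k. n \<le> k \<Longrightarrow> ((\<lambda>i. X i k * X i (k + 1)) \<longlongrightarrow> x k * x (k + 1)) F"
  shows "((\<lambda>i. FF_from n (X i)) \<longlongrightarrow> FF_from n x) F"
  unfolding FF_from_def
proof (rule FF_tendsto[OF assms(1)])
  show "\<forall>\<^sub>F i in F. \<forall>k. cmod ((if k < n then 0 else X i k) * (if k + 1 < n then 0 else X i (k + 1))) \<le> B k"
    using assms(2) by eventually_elim (use assms(3) in auto)
  show "((\<lambda>i. (if k < n then 0 else X i k) * (if k + 1 < n then 0 else X i (k + 1)))
      \<longlongrightarrow> (if k < n then 0 else x k) * (if k + 1 < n then 0 else x (k + 1))) F" for k
    using assms(4)[of k] by auto
qed

lemma FF_from_at_bot: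
  assumes "(\<lambda>k. cmod (x k * x (k + 1))) summable_on UNIV"
  shows "((\<lambda>n. FF_from n x) \<longlongrightarrow> FF x) at_bot"
  unfolding FF_from_def
proof (rule FF_tendsto[OF assms])
  show "((\<lambda>n. (if k < n then 0 else x k) * (if k + 1 < n then 0 else x (k + 1))) \<longlongrightarrow> x k * x (k + 1)) at_bot" for k
    by (rule tendsto_eventually) (use eventually_le_at_bot[of k] in eventually_elim, auto)
qed auto

lemma FF_zero: "FF (\<lambda>_. 0) = 1"
  by (simp add: FF_def)

text \<open>The truncated sequences tend pointwise to the zero sequence under a fixed majorant, and
  \<open>FF\<close> of the zero sequence is \<open>1\<close>.\<close>

lemma FF_from_at_top:
  assumes "B summable_on UNIV" "\<And>k. N \<le> k \<Longrightarrow> cmod (x k * x (k + 1)) \<le> B k" "\<And>k. 0 \<le> B k"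
  shows "((\<lambda>n. FF_from n x) \<longlongrightarrow> 1) at_top"
proof -
  have "((\<lambda>n. FF_from n x) \<longlongrightarrow> FF (\<lambda>_. 0)) at_top"
    unfolding FF_from_def
  proof (rule FF_tendsto[OF assms(1)])
    show "\<forall>\<^sub>F n in at_top. \<forall>k. cmod ((if k < n then 0 else x k) * (if k + 1 < n then 0 else x (k + 1))) \<le> B k"
      using eventually_ge_at_top[of N] by eventually_elim (use assms in auto)
    show "((\<lambda>n. (if k < n then 0 else x k) * (if k + 1 < n then 0 else x (k + 1))) \<longlongrightarrow> 0 * 0) at_top" for k
      by (rule tendsto_eventually) (use eventually_gt_at_top[of k] in eventually_elim, auto)
  qed
  then show ?thesis by (simp add: FF_zero)
qed

section \<open>Recurrence of the tails and splitting at an index\<close>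

lemma nested_sum_cut:
  "n \<le> j \<Longrightarrow> nested_sum (\<lambda>k. if k < n then 0 else x k) m {j..} = nested_sum x m {j..}"
proof (induction m arbitrary: j)
  case (Suc m)
  then show ?case unfolding nested_sum.simps by (intro infsum_cong) auto
qed simp

text \<open>The leading \<open>1\<close> of \<open>FF\<close> becomes the term \<open>m = 0\<close>,
  so that the recurrence can be proved term by term.\<close>

lemma FF_from_sums:
  assumes B: "B summable_on UNIV" and le: "\<And>k. cmod (x k * x (k + 1)) \<le> B k"
  shows "(\<lambda>m. (- 1) ^ m * nested_sum x m {n..}) sums FF_from n x"
proof -
  obtain C where C: "cmod (nested_sum x m A) \<le> C / 2 ^ m" for m A
    using nested_sum_bound[OF B] le by metis
  have sm: "summable (\<lambda>m. (- 1) ^ m * nested_sum x m {n..})"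
  proof (rule summable_comparison_test)
    show "\<exists>N. \<forall>m\<ge>N. norm ((- 1) ^ m * nested_sum x m {n..}) \<le> C * (1 / 2) ^ m"
      using C by (simp add: norm_mult norm_power power_divide)
    show "summable (\<lambda>m. C * (1 / 2) ^ m)" by (intro summable_mult summable_geometric) simp
  qed
  have "nested_sum (\<lambda>k. if k < n then 0 else x k) (Suc m) UNIV = nested_sum x (Suc m) {n..}" for m
    unfolding nested_sum.simps
    by (rule infsum_cong_neutral) (auto simp: nested_sum_cut)
  then have "FF_from n x = 1 + (\<Sum>m. (- 1) ^ Suc m * nested_sum x (Suc m) {n..})"
    by (simp only: FF_from_def FF_def)
  also have "\<dots> = (\<Sum>m. (- 1) ^ m * nested_sum x m {n..})"
    using suminf_split_head[OF sm] by simp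
  finally show ?thesis using sm by (simp add: sums_iff)
qed

text \<open>The nested sums are sorted by their smallest index: if it is \<open>n\<close>, the
  remaining ones start at \<open>n + 2\<close> and one factor \<open>-1\<close> is split off;
  otherwise all start at \<open>n + 1\<close>.\<close>

lemma FF_from_rec:
  assumes s: "B summable_on UNIV" and le: "\<And>k. n \<le> k \<Longrightarrow> cmod (x k * x (k + 1)) \<le> B k"
    and B0: "\<And>k. 0 \<le> B k"
  shows "FF_from n x = FF_from (n + 1) x - x n * x (n + 1) * FF_from (n + 2) x"
proof -
  \<comment> \<open>Truncation extends the bound, given only from \<open>n\<close> on, to all
    indices without changing the tails involved.\<close>
  define y where "y k = (if k < n then 0 else x k)" for k
  have y: "cmod (y k * y (k + 1)) \<le> B k" for k using le B0 by (auto simp: y_def)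
  have xy: "FF_from j x = FF_from j y" if "n \<le> j" for j
    by (rule FF_from_cong) (use that in \<open>auto simp: y_def\<close>)
  note sums = FF_from_sums[OF s y]
  obtain C where C: "cmod (nested_sum y m A) \<le> C / 2 ^ m" for m A
    using nested_sum_bound[OF s] y by metis
  have split: "nested_sum y (Suc m) {n..} =
      y n * y (n + 1) * nested_sum y m {n + 2..} + nested_sum y (Suc m) {n + 1..}" for m
    unfolding nested_sum.simps
  proof (rule infsum_atLeast_int)
    show "(\<lambda>k. y k * y (k + 1) * nested_sum y m {k + 2..}) summable_on {n + 1..}"
    proof (rule summable_on_norm_bound(1))
      show "(\<lambda>k. B k * (C / 2 ^ m)) summable_on UNIV"
        by (rule summable_on_cmult_left[OF s])
      show "cmod (y k * y (k + 1) * nested_sum y m {k + 2..}) \<le> B k * (C / 2 ^ m)" for k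
        unfolding norm_mult[of "y k * y (k + 1)"] by (intro mult_mono y C B0) auto
    qed auto
  qed
  have sucs: "(\<lambda>m. (- 1) ^ Suc m * nested_sum y (Suc m) {j..}) sums (FF_from j y - 1)" for j
    using sums[of j] by (subst sums_Suc_iff) simp
  have "(\<lambda>m. (- 1) ^ Suc m * nested_sum y (Suc m) {n..}) sums
      (- (y n * y (n + 1)) * FF_from (n + 2) y + (FF_from (n + 1) y - 1))"
    using sums_add[OF sums_mult[OF sums[of "n + 2"], of "- (y n * y (n + 1))"] sucs[of "n + 1"]]
    unfolding split by (simp add: algebra_simps)
  from sums_unique2[OF this sucs] have "FF_from n y = FF_from (n + 1) y - y n * y (n + 1) * FF_from (n + 2) y"
    by (simp add: algebra_simps)
  then show ?thesis by (simp add: xy) (simp add: y_def)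
qed

text \<open>The right-hand side is independent of \<open>n\<close> by the recurrences, and converges to the left-hand
  side as \<open>n\<close> tends to \<open>-\<infinity>\<close>.\<close>

lemma FF_split:
  assumes s: "(\<lambda>k. cmod (x k * x (k + 1))) summable_on UNIV"
  defines "\<psi> \<equiv> \<lambda>n. FF_from (- n) (\<lambda>k. x (- k))"
  shows "FF x = \<psi> n * FF_from (n + 1) x - x n * x (n + 1) * \<psi> (n - 1) * FF_from (n + 2) x"
proof -
  define a where "a k = x k * x (k + 1)" for k
  define D where "D n = \<psi> n * FF_from (n + 1) x - a n * \<psi> (n - 1) * FF_from (n + 2) x" for n
  \<comment> \<open>The substitution \<open>k \<mapsto> -k - 1\<close> maps the pair
    \<open>(k, k + 1)\<close> to the reflected pair in reversed order.\<close>
  have s': "(\<lambda>k. cmod (x (- k) * x (- (k + 1)))) summable_on UNIV"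
    by (rule iffD1[OF summable_on_reindex_bij_witness[of UNIV "\<lambda>k. - k - 1" "\<lambda>k. - k - 1"] s])
       (auto simp: mult.commute add.commute)
  have \<phi>: "FF_from m x = FF_from (m + 1) x - a m * FF_from (m + 2) x" for m
    unfolding a_def by (rule FF_from_rec[OF s]) auto
  have \<psi>: "\<psi> (m + 1) = \<psi> m - a m * \<psi> (m - 1)" for m
    using FF_from_rec[OF s' order_refl norm_ge_zero, of "- m - 1"]
    by (simp add: \<psi>_def a_def algebra_simps minus_diff_commute[of 1 m])
  have step: "D (m + 1) = D m" for m
  proof -
    have \<phi>': "FF_from (m + 1) x = FF_from (m + 2) x - a (m + 1) * FF_from (m + 3) x"
      using \<phi>[of "m + 1"] by (simp add: algebra_simps)
    show ?thesis unfolding D_def \<psi> \<phi>' by (simp add: algebra_simps)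
  qed
  have const: "D m = D 0" for m
  proof (induction m rule: int_induct[of _ 0])
    case (step1 i)
    then show ?case using step[of i] by simp
  next
    case (step2 i)
    then show ?case using step[of "i - 1"] by simp
  qed simp
  have "filterlim uminus at_top (at_bot :: int filter)"
    unfolding filterlim_at_top
  proof
    fix Z :: int show "\<forall>\<^sub>F k in at_bot. Z \<le> - k"
      using eventually_le_at_bot[of "- Z"] by eventually_elim simp
  qed
  then have \<psi>1: "(\<psi> \<longlongrightarrow> 1) at_bot"
    unfolding \<psi>_def
    by (rule filterlim_compose[OF FF_from_at_top[OF s' order_refl norm_ge_zero]])
  \<comment> \<open>As \<open>n\<close> tends to \<open>-\<infinity>\<close>, the second term of
    \<open>D n\<close> vanishes because \<open>a\<close> does, while the first tends to
    \<open>1 * FF x\<close>.\<close>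
  have a0: "(\<lambda>i. a (- int i)) \<longlonglongrightarrow> 0"
  proof -
    have "(\<lambda>k. cmod (a k)) summable_on range (\<lambda>i. - int i)"
      unfolding a_def by (rule summable_on_subset[OF s]) simp
    then have "(\<lambda>i. cmod (a (- int i))) summable_on UNIV"
      by (subst (asm) summable_on_reindex) (auto simp: inj_on_def o_def)
    then show ?thesis
      using summable_LIMSEQ_zero[OF summable_on_imp_summable] tendsto_norm_zero_iff by blast
  qed
  have shift: "filterlim (\<lambda>i. - int i + c) at_bot sequentially" for c
    unfolding filterlim_at_bot
  proof
    fix Z :: int show "\<forall>\<^sub>F i in sequentially. - int i + c \<le> Z"
      using eventually_ge_at_top[of "nat (c - Z)"] by eventually_elim linarith
  qed
  note \<phi>F = FF_from_at_bot[OF s]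
  have "(\<lambda>i. D (- int i)) \<longlonglongrightarrow> 1 * FF x - 0 * 1 * FF x"
    unfolding D_def
    by (intro tendsto_diff tendsto_mult a0 filterlim_compose[OF \<phi>F shift]
        filterlim_compose[OF \<psi>1 shift[of 0, simplified]]
        filterlim_compose[OF \<psi>1 shift[of "-1", simplified]])
  then have "(\<lambda>i. D n) \<longlonglongrightarrow> FF x"
    using const by (simp add: const[of "- int i" for i] const[of n])
  then show ?thesis
    by (simp add: LIMSEQ_const_iff D_def a_def)
qed

subsection \<open>Solutions of the eigenvalue equation\<close>


text \<open>As \<open>w\<close> has no zeros, the recurrence can be solved for either outer value,
  so two neighbouring values determine a solution in both directions.\<close>

lemma jacobi_solution_eq_zero:
  assumes w: "\<forall>n. w n \<noteq> 0"
    and sol: "\<And>n. jacobi_matrix lam w x n = z * x n"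
    and "x m = 0" "x (m + 1) = 0"
  shows "x n = 0"
proof -
  have "x n = 0 \<and> x (n + 1) = 0"
  proof (induction n rule: int_induct[of _ m])
    case (step1 i)
    then show ?case using sol[of "i + 1"] w by (simp add: jacobi_matrix_def)
  next
    case (step2 i)
    then show ?case using sol[of i] w by (simp add: jacobi_matrix_def)
  qed (use assms in simp)
  then show ?thesis ..
qed

lemma jacobi_matrix_lincomb:
  "jacobi_matrix lam w (\<lambda>n. a * x n - b * y n) n
    = a * jacobi_matrix lam w x n - b * jacobi_matrix lam w y n"
  by (simp add: jacobi_matrix_def algebra_simps)

text \<open>The weight \<open>w n\<close> couples \<open>n\<close> with \<open>n + 1\<close>;
  reflection turns this edge into the one from \<open>-n - 1\<close> to \<open>-n\<close>, whence
  the shift in \<open>w\<close>.\<close>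

lemma jacobi_matrix_reflect:
  "jacobi_matrix (\<lambda>n. lam (- n)) (\<lambda>n. w (- n - 1)) x n = jacobi_matrix lam w (\<lambda>n. x (- n)) (- n)"
  by (simp add: jacobi_matrix_def algebra_simps)

text \<open>For \<open>j\<close> equal to \<open>m\<close> or \<open>m + 1\<close>, the solution
  \<open>y j * x n - x j * y n\<close> vanishes at both \<open>m\<close> and \<open>m + 1\<close>,
  once trivially and once by the Wronskian, hence everywhere. One of the two \<open>y j\<close> is
  nonzero.\<close>

lemma jacobi_solutions_proportional:
  assumes w: "\<forall>n. w n \<noteq> 0"
    and x: "\<And>n. jacobi_matrix lam w x n = z * x n"
    and y: "\<And>n. jacobi_matrix lam w y n = z * y n"
    and wronskian: "x (m + 1) * y m = x m * y (m + 1)"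
    and y0: "y \<noteq> (\<lambda>n. 0)"
  shows "\<exists>c. \<forall>n. x n = c * y n"
proof -
  have *: "y j * x n = x j * y n" if "j = m \<or> j = m + 1" for j n
  proof -
    have "y j * x n - x j * y n = 0"
    proof (rule jacobi_solution_eq_zero[OF w, of lam "\<lambda>n. y j * x n - x j * y n" z m])
      show "jacobi_matrix lam w (\<lambda>n. y j * x n - x j * y n) n = z * (y j * x n - x j * y n)" for n
        by (simp only: jacobi_matrix_lincomb x y) (simp add: algebra_simps)
    qed (use that wronskian in \<open>auto simp: mult.commute\<close>)
    then show ?thesis by simp
  qed
  have "y m \<noteq> 0 \<or> y (m + 1) \<noteq> 0"
    using jacobi_solution_eq_zero[OF w y, of m] y0 by blast
  then obtain j where j: "y j \<noteq> 0" "j = m \<or> j = m + 1" by blast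
  have "x n = x j / y j * y n" for n
    using *[OF j(2), of n] j(1) by (simp add: field_simps)
  then show ?thesis by blast
qed

text \<open>If every disc around \<open>z\<close> caught infinitely many indices, one could choose
  indices of strictly increasing absolute value, hence pairwise distinct, along which
  \<open>lam\<close> tends to \<open>z\<close>.\<close>

lemma not_der_isolated:
  assumes "z \<notin> der lam"
  obtains \<epsilon> where "\<epsilon> > 0" "finite {n. lam n = z}" "\<And>n. lam n \<noteq> z \<Longrightarrow> \<epsilon> \<le> cmod (lam n - z)"
proof -
  have "\<exists>\<delta>>0. finite {n. cmod (lam n - z) < \<delta>}"
  proof (rule ccontr)
    assume "\<not> ?thesis"
    then have inf: "infinite {n. cmod (lam n - z) < inverse (real (Suc i))}" for i by simp
    have ex: "\<exists>k'. cmod (lam k' - z) < inverse (real (Suc i)) \<and> B < \<bar>k'\<bar>" for i and B :: int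
    proof (rule ccontr)
      assume "\<not> ?thesis"
      then have "{n. cmod (lam n - z) < inverse (real (Suc i))} \<subseteq> {-B..B}" by force
      then show False using inf[of i] finite_subset by blast
    qed
    obtain k where k: "\<And>i. cmod (lam (k i) - z) < inverse (real (Suc i))"
        and kk: "\<And>i. \<bar>k i\<bar> < \<bar>k (Suc i)\<bar>"
      using dependent_nat_choice[of "\<lambda>i k. cmod (lam k - z) < inverse (real (Suc i))"
          "\<lambda>i k k'. \<bar>k\<bar> < \<bar>k'\<bar>"] ex by metis
    have "strict_mono (\<lambda>i. \<bar>k i\<bar>)" using kk by (simp add: strict_mono_Suc_iff)
    then have "inj k" by (metis (no_types, lifting) injI strict_mono_eq)
    moreover have "(\<lambda>i. lam (k i)) \<longlonglongrightarrow> z"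
    proof (rule LIM_zero_cancel, rule Lim_null_comparison)
      show "\<forall>\<^sub>F i in sequentially. norm (lam (k i) - z) \<le> inverse (real (Suc i))"
        using k by (simp add: less_imp_le)
    qed (rule LIMSEQ_inverse_real_of_nat)
    ultimately show False using assms by (auto simp: der_def)
  qed
  then obtain \<delta> where \<delta>: "\<delta> > 0" "finite {n. cmod (lam n - z) < \<delta>}" by blast
  \<comment> \<open>Inserting \<open>\<delta>\<close> keeps the minimum defined when no other value
    lies in the disc, and covers the indices outside it.\<close>
  define D where "D = insert \<delta> ((\<lambda>n. cmod (lam n - z)) ` {n. cmod (lam n - z) < \<delta> \<and> lam n \<noteq> z})"
  have finD: "finite D" unfolding D_def by (auto intro: finite_subset[OF _ \<delta>(2)])
  show ?thesis
  proof (rule that[of "Min D"])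
    have "D \<noteq> {}" by (simp add: D_def)
    then show "Min D > 0" using finD \<delta>(1) by (auto simp: Min_gr_iff) (auto simp: D_def)
    show "finite {n. lam n = z}" by (rule finite_subset[OF _ \<delta>(2)]) (use \<delta>(1) in auto)
    show "Min D \<le> cmod (lam n - z)" if "lam n \<noteq> z" for n
    proof (cases "cmod (lam n - z) < \<delta>")
      case True
      then show ?thesis using that by (intro Min_le[OF finD]) (auto simp: D_def)
    next
      case False
      moreover have "Min D \<le> \<delta>" by (intro Min_le[OF finD]) (auto simp: D_def)
      ultimately show ?thesis by linarith
    qed
  qed
qed

section \<open>The solution at a regular spectral parameter\<close>

lemma PP_Suc:
  assumes w: "\<forall>n. w n \<noteq> 0" and u: "\<And>k. lam k \<noteq> u"
  shows "PP lam w u (n + 1) = PP lam w u n * (w n / (u - lam (n + 1)))"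
proof -
  have nz: "u - lam k \<noteq> 0" for k using u[of k] by simp
  consider "n \<ge> 0" | "n = -1" | "n < -1" by linarith
  then show ?thesis
  proof cases
    case 1
    then have "{1..n + 1} = insert (n + 1) {1..n}" by auto
    then show ?thesis using 1 by (simp add: PP_def)
  next
    case 2
    then show ?thesis using w nz by (simp add: PP_def)
  next
    case 3
    then have "{n + 1..0} = insert (n + 1) {n + 2..0}" by auto
    then show ?thesis using 3 w nz[of "n + 1"] by (simp add: PP_def add.commute)
  qed
qed

text \<open>The entries at \<open>n - 1\<close>, \<open>n\<close>, \<open>n + 1\<close> carry the
  tails from \<open>n\<close>, \<open>n + 1\<close>, \<open>n + 2\<close>. Expressing all prefactors
  through \<open>P n\<close> gives \<open>(u - lam n) * P n\<close> times the tail
  recurrence.\<close>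

lemma f_regular_solution:
  assumes w: "\<forall>n. w n \<noteq> 0" and gamma: "\<forall>n. \<gamma> n * \<gamma> (n + 1) = w n"
    and u: "\<And>k. lam k \<noteq> u"
    and s: "(\<lambda>k. cmod ((w k)\<^sup>2 / ((lam k - u) * (lam (k + 1) - u)))) summable_on UNIV"
  shows "jacobi_matrix lam w (f_regular lam w \<gamma> u) n = u * f_regular lam w \<gamma> u n"
proof -
  define x where "x k = (\<gamma> k)\<^sup>2 / (lam k - u)" for k
  have x: "x k * x (k + 1) = (w k)\<^sup>2 / ((lam k - u) * (lam (k + 1) - u))" for k
    unfolding x_def using gamma[rule_format, of k, symmetric] by (simp add: power_mult_distrib)
  have nz: "u - lam k \<noteq> 0" "lam k - u \<noteq> 0" for k using u[of k] by simp_all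
  have sx: "(\<lambda>k. cmod (x k * x (k + 1))) summable_on UNIV" using s unfolding x .
  have rec: "FF_from n x = FF_from (n + 1) x - (w n)\<^sup>2 / ((lam n - u) * (lam (n + 1) - u)) * FF_from (n + 2) x"
    using FF_from_rec[OF sx order_refl norm_ge_zero, of n] unfolding x .
  define P where "P = PP lam w u"
  have P1: "P (n + 1) = P n * (w n / (u - lam (n + 1)))"
    unfolding P_def by (rule PP_Suc[OF w u])
  have "P n = P (n - 1) * (w (n - 1) / (u - lam n))"
    unfolding P_def using PP_Suc[where n = "n - 1", OF w u] by simp
  then have P0: "w (n - 1) * P (n - 1) = (u - lam n) * P n"
    using nz[of n] by (simp add: field_simps)
  have f: "f_regular lam w \<gamma> u k = P k * FF_from (k + 1) x" for k
    by (simp add: f_regular_def P_def x_def[abs_def])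
  have "jacobi_matrix lam w (f_regular lam w \<gamma> u) n - u * f_regular lam w \<gamma> u n
      = (w (n - 1) * P (n - 1)) * FF_from n x + (lam n - u) * P n * FF_from (n + 1) x
        + w n * P (n + 1) * FF_from (n + 2) x"
    by (simp add: jacobi_matrix_def f algebra_simps)
  also have "\<dots> = 0"
  proof -
    define p where "p = u - lam n"
    define q where "q = u - lam (n + 1)"
    have pq: "lam n - u = - p" "lam (n + 1) - u = - q" by (simp_all add: p_def q_def)
    have "p \<noteq> 0" "q \<noteq> 0" using nz by (simp_all add: p_def q_def)
    then show ?thesis
      unfolding P0 P1 rec pq p_def[symmetric] q_def[symmetric] by (simp add: field_simps power2_eq_square)
  qed
  finally show ?thesis by simp
qed

text \<open>Local data at one point \<open>z\<close> outside \<open>der lam\<close>, which may or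
  may not be a value of \<open>lam\<close>. The assumptions are stable under index reflection, so
  everything can be instantiated a second time for \<open>-\<infinity>\<close>.\<close>

locale jacobi_point =
  fixes lam w \<gamma> :: "int \<Rightarrow> complex" and z z0 :: complex and \<epsilon> :: real
  assumes w_nonzero: "\<forall>n. w n \<noteq> 0"
    and gamma: "\<forall>n. \<gamma> n * \<gamma> (n + 1) = w n"
    and z0: "\<And>n. lam n \<noteq> z0"
    and summable_z0: "(\<lambda>n. cmod ((w n)\<^sup>2 / ((lam n - z0) * (lam (n + 1) - z0)))) summable_on UNIV"
    and eps: "\<epsilon> > 0"
    and separated: "\<And>n. lam n \<noteq> z \<Longrightarrow> \<epsilon> \<le> cmod (lam n - z)"
    and finite_z: "finite {n. lam n = z}"
begin

abbreviation f where "f \<equiv> f_regular lam w \<gamma>"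

section \<open>Uniform estimates near \<open>z\<close>\<close>

definition coeff :: "complex \<Rightarrow> int \<Rightarrow> complex" where
  "coeff u n = (w n)\<^sup>2 / ((lam n - u) * (lam (n + 1) - u))"

text \<open>Chosen so that \<open>cmod (lam n - z0) \<le> K * cmod (lam n - u)\<close> follows from
  the triangle inequality and \<open>\<epsilon> / 2 \<le> cmod (lam n - u)\<close>. It enters the
  majorant squared because \<open>coeff\<close> has two such denominators.\<close>

definition K :: real where "K = 1 + (cmod (z - z0) + \<epsilon> / 2) / (\<epsilon> / 2)"

definition majorant :: "int \<Rightarrow> real" where "majorant n = K\<^sup>2 * cmod (coeff z0 n)"

definition x :: "complex \<Rightarrow> int \<Rightarrow> complex" where "x u n = (\<gamma> n)\<^sup>2 / (lam n - u)"

lemma x_mult: "x u k * x u (k + 1) = coeff u k"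
  unfolding x_def coeff_def using gamma[rule_format, of k, symmetric] by (simp add: power_mult_distrib)

lemma f_eq: "f u n = PP lam w u n * FF_from (n + 1) (x u)"
  by (simp add: f_regular_def x_def[abs_def])

lemma majorant_nonneg: "0 \<le> majorant n"
  by (simp add: majorant_def)

lemma summable_majorant: "majorant summable_on UNIV"
  unfolding majorant_def[abs_def] coeff_def by (rule summable_on_cmult_right[OF summable_z0])

lemma dist_lam:
  assumes "cmod (u - z) \<le> \<epsilon> / 2" "lam n \<noteq> z"
  shows "\<epsilon> / 2 \<le> cmod (lam n - u)"
proof -
  have "cmod (lam n - z) \<le> cmod (lam n - u) + cmod (u - z)"
    using norm_triangle_ineq[of "lam n - u" "u - z"] by simp
  then show ?thesis using separated[OF assms(2)] assms(1) by linarith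
qed

lemma ratio_le:
  assumes "cmod (u - z) \<le> \<epsilon> / 2" "lam n \<noteq> z"
  shows "cmod (lam n - z0) \<le> K * cmod (lam n - u)"
proof -
  have "cmod (lam n - z0) \<le> cmod (lam n - u) + (cmod (u - z) + cmod (z - z0))"
    using norm_triangle_ineq[of "lam n - u" "u - z0"] norm_triangle_ineq[of "u - z" "z - z0"] by simp
  also have "\<dots> \<le> cmod (lam n - u) + (cmod (z - z0) + \<epsilon> / 2) / (\<epsilon> / 2) * (\<epsilon> / 2)"
    using assms(1) eps by simp
  also have "\<dots> \<le> cmod (lam n - u) + (cmod (z - z0) + \<epsilon> / 2) / (\<epsilon> / 2) * cmod (lam n - u)"
    using eps by (intro add_left_mono mult_left_mono dist_lam[OF assms]) auto
  finally show ?thesis by (simp add: K_def algebra_simps)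
qed

lemma coeff_le_majorant:
  assumes "cmod (u - z) \<le> \<epsilon> / 2" "lam n \<noteq> z" "lam (n + 1) \<noteq> z"
  shows "cmod (coeff u n) \<le> majorant n"
proof -
  define p where "p = cmod (lam n - u)"
  define q where "q = cmod (lam (n + 1) - u)"
  define p0 where "p0 = cmod (lam n - z0)"
  define q0 where "q0 = cmod (lam (n + 1) - z0)"
  have pos: "p > 0" "q > 0" using dist_lam[OF assms(1)] assms(2,3) eps
    unfolding p_def q_def by fastforce+
  have pos0: "p0 > 0" "q0 > 0" using z0 unfolding p0_def q0_def by auto
  have "p0 * q0 \<le> (K * p) * (K * q)"
    unfolding p0_def q0_def p_def q_def
    by (intro mult_mono ratio_le assms mult_nonneg_nonneg) (use eps in \<open>auto simp: K_def\<close>)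
  then have "inverse (p * q) \<le> K\<^sup>2 * inverse (p0 * q0)"
    using pos pos0 by (simp add: field_simps power2_eq_square)
  from mult_left_mono[OF this, of "(cmod (w n))\<^sup>2"]
  show ?thesis
    by (simp add: majorant_def coeff_def norm_divide norm_mult norm_power p_def q_def p0_def q0_def
        divide_inverse norm_inverse mult_ac)
qed

lemma summable_coeff:
  assumes "cmod (u - z) \<le> \<epsilon> / 2"
  shows "(\<lambda>n. cmod (coeff u n)) summable_on UNIV"
proof -
  \<comment> \<open>Each occurrence of \<open>z\<close> affects two neighbouring terms, finitely
    many in all. At \<open>u = z\<close> those terms are \<open>0\<close> by the convention for
    division by zero.\<close>
  define E where "E = {n. lam n = z} \<union> (\<lambda>n. n - 1) ` {n. lam n = z}"
  have "finite E" unfolding E_def using finite_z by simp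
  then have 1: "(\<lambda>n. cmod (coeff u n)) summable_on E" by (rule summable_on_finite)
  have "majorant summable_on - E" by (rule summable_on_subset[OF summable_majorant]) simp
  then have 2: "(\<lambda>n. cmod (coeff u n)) summable_on - E"
  proof (rule summable_on_comparison_test)
    fix n assume "n \<in> - E"
    then show "cmod (coeff u n) \<le> majorant n"
      by (intro coeff_le_majorant assms) (auto simp: E_def image_iff)
  qed simp
  show ?thesis using summable_on_union[OF 1 2] by simp
qed

lemma f_solution:
  assumes "cmod (u - z) \<le> \<epsilon> / 2" "\<And>k. lam k \<noteq> u"
  shows "jacobi_matrix lam w (f u) n = u * f u n"
  by (rule f_regular_solution[OF w_nonzero gamma assms(2)])
     (use summable_coeff[OF assms(1)] in \<open>simp add: coeff_def\<close>)

lemma lam_neq_near: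
  assumes "cmod (u - z) \<le> \<epsilon> / 2" "u \<noteq> z"
  shows "lam k \<noteq> u"
  using dist_lam[OF assms(1), of k] assms(2) eps by auto

lemma eventually_near: "\<forall>\<^sub>F u in at z. cmod (u - z) \<le> \<epsilon> / 2 \<and> u \<noteq> z"
  using eps by (auto simp: eventually_at dist_norm intro!: exI[of _ "\<epsilon> / 2"])

section \<open>The rescaled solution and its limit at \<open>z\<close>\<close>

definition top_z :: int where "top_z = Max (insert 0 {n. lam n = z})"

text \<open>The inserted \<open>0\<close> keeps the maximum defined when \<open>z\<close> is not a
  value, and puts all indices from \<open>top_z\<close> on into the first branch of
  \<open>PP\<close>.\<close>

lemma top_z: "0 \<le> top_z" "top_z < k \<Longrightarrow> lam k \<noteq> z"
proof -
  show "0 \<le> top_z" unfolding top_z_def using finite_z by (intro Max_ge) auto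
  have "lam k = z \<Longrightarrow> k \<le> top_z" unfolding top_z_def using finite_z by (intro Max_ge) auto
  then show "top_z < k \<Longrightarrow> lam k \<noteq> z" by linarith
qed

text \<open>The prefactor \<open>PP\<close> with its poles at \<open>z\<close> cancelled: each
  denominator \<open>u - lam k\<close> that would vanish at \<open>u = z\<close> is replaced by
  \<open>1\<close>.\<close>

definition R :: "complex \<Rightarrow> int \<Rightarrow> complex" where
  "R u n = (\<Prod>k\<in>{1..n}. w (k - 1) / (if lam k = z then 1 else u - lam k))"

lemma R_eq:
  assumes "top_z \<le> n" "u \<noteq> z"
  shows "(u - z) ^ r_plus lam z * PP lam w u n = R u n"
proof -
  have "{k. k > 0 \<and> lam k = z} = {k\<in>{1..n}. lam k = z}"
  proof -
    have "k \<le> n" if "lam k = z" for k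
      using that top_z(2)[of k] assms(1) by linarith
    then show ?thesis by auto
  qed
  then have "(u - z) ^ r_plus lam z = (\<Prod>k\<in>{1..n}. if lam k = z then u - z else 1)"
    unfolding r_plus_def by (simp add: prod.inter_filter[symmetric])
  moreover have "PP lam w u n = (\<Prod>k\<in>{1..n}. w (k - 1) / (u - lam k))"
    using assms(1) top_z(1) by (simp add: PP_def)
  ultimately show ?thesis unfolding R_def
    using assms(2) by (simp add: prod.distrib[symmetric]) (rule prod.cong, auto)
qed

lemma R_nonzero: "R z n \<noteq> 0"
  using w_nonzero by (auto simp: R_def)

lemma R_Suc:
  assumes "top_z \<le> n"
  shows "R z (n + 1) = R z n * (w n / (z - lam (n + 1)))"
proof -
  have "{1..n + 1} = insert (n + 1) {1..n}" using assms top_z(1) by auto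
  then show ?thesis using top_z(2)[of "n + 1"] assms by (simp add: R_def)
qed

definition scaled :: "complex \<Rightarrow> int \<Rightarrow> complex" where
  "scaled u n = (u - z) ^ r_plus lam z * f u n"

text \<open>Beyond \<open>top_z\<close> the tail meets no value equal to \<open>z\<close>, so the
  majorant dominates its products for all \<open>u\<close> near \<open>z\<close>, and
  \<open>R\<close> is continuous there.\<close>

lemma scaled_tendsto_top:
  assumes "top_z \<le> n"
  shows "((\<lambda>u. scaled u n) \<longlongrightarrow> R z n * FF_from (n + 1) (x z)) (at z)"
proof -
  have "((\<lambda>u. R u n) \<longlongrightarrow> R z n) (at z)"
    unfolding R_def by (intro tendsto_prod tendsto_divide tendsto_const) (auto intro!: tendsto_eq_intros)
  moreover have "((\<lambda>u. FF_from (n + 1) (x u)) \<longlongrightarrow> FF_from (n + 1) (x z)) (at z)"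
  proof (rule FF_from_tendsto[OF summable_majorant _ majorant_nonneg])
    show "\<forall>\<^sub>F u in at z. \<forall>k\<ge>n + 1. cmod (x u k * x u (k + 1)) \<le> majorant k"
      using eventually_near
    proof eventually_elim
      case (elim u)
      show ?case unfolding x_mult
        using elim assms by (intro allI impI coeff_le_majorant top_z(2)) auto
    qed
    fix k assume "n + 1 \<le> k"
    then have "lam k \<noteq> z" "lam (k + 1) \<noteq> z" using top_z(2) assms by auto
    then show "((\<lambda>u. x u k * x u (k + 1)) \<longlongrightarrow> x z k * x z (k + 1)) (at z)"
      unfolding x_mult coeff_def by (intro tendsto_intros) auto
  qed
  ultimately have "((\<lambda>u. R u n * FF_from (n + 1) (x u)) \<longlongrightarrow> R z n * FF_from (n + 1) (x z)) (at z)"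
    by (rule tendsto_mult)
  then show ?thesis
  proof (rule Lim_transform_eventually)
    show "\<forall>\<^sub>F u in at z. R u n * FF_from (n + 1) (x u) = scaled u n"
      using eventually_near
      by eventually_elim (simp add: scaled_def f_eq R_eq[OF assms, symmetric])
  qed
qed

lemma scaled_solution:
  assumes "cmod (u - z) \<le> \<epsilon> / 2" "u \<noteq> z"
  shows "jacobi_matrix lam w (scaled u) n = u * scaled u n"
  using f_solution[OF assms(1) lam_neq_near[OF assms], of n]
    jacobi_matrix_lincomb[of lam w "(u - z) ^ r_plus lam z" "f u" 0 "\<lambda>_. 0" n]
  by (simp add: scaled_def[abs_def])

lemma scaled_convergent: "\<exists>l. ((\<lambda>u. scaled u n) \<longlongrightarrow> l) (at z)"
proof (cases "top_z \<le> n")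
  case False
  then have "n \<le> top_z" by simp
  \<comment> \<open>The recurrence has order two, so the downward induction carries the limits at
    two neighbouring indices.\<close>
  then have "(\<exists>l. ((\<lambda>u. scaled u n) \<longlongrightarrow> l) (at z)) \<and> (\<exists>l. ((\<lambda>u. scaled u (n + 1)) \<longlongrightarrow> l) (at z))"
  proof (induction n rule: int_le_induct[of _ top_z])
    case base
    show ?case using scaled_tendsto_top[of top_z] scaled_tendsto_top[of "top_z + 1"] by auto
  next
    case (step i)
    then obtain l l' where l: "((\<lambda>u. scaled u i) \<longlongrightarrow> l) (at z)" "((\<lambda>u. scaled u (i + 1)) \<longlongrightarrow> l') (at z)"
      by blast
    have "((\<lambda>u. ((u - lam i) * scaled u i - w i * scaled u (i + 1)) / w (i - 1))
        \<longlongrightarrow> ((z - lam i) * l - w i * l') / w (i - 1)) (at z)"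
      using w_nonzero by (intro tendsto_intros l) auto
    then have "((\<lambda>u. scaled u (i - 1)) \<longlongrightarrow> ((z - lam i) * l - w i * l') / w (i - 1)) (at z)"
    proof (rule Lim_transform_eventually)
      show "\<forall>\<^sub>F u in at z. ((u - lam i) * scaled u i - w i * scaled u (i + 1)) / w (i - 1) = scaled u (i - 1)"
        using eventually_near
      proof eventually_elim
        case (elim u)
        then show ?case using scaled_solution[of u i] w_nonzero
          by (simp add: jacobi_matrix_def field_simps)
      qed
    qed
    then show ?case using l(1) by auto
  qed
  then show ?thesis ..
qed (use scaled_tendsto_top in blast)

definition L :: "int \<Rightarrow> complex" where "L n = Lim (at z) (\<lambda>u. scaled u n)"

lemma scaled_tendsto: "((\<lambda>u. scaled u n) \<longlongrightarrow> L n) (at z)"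
  using scaled_convergent[of n] unfolding L_def by (metis tendsto_Lim trivial_limit_at)

lemma L_top: "top_z \<le> n \<Longrightarrow> L n = R z n * FF_from (n + 1) (x z)"
  using tendsto_unique[OF _ scaled_tendsto scaled_tendsto_top] by simp

lemma L_solution: "jacobi_matrix lam w L n = z * L n"
proof -
  have "((\<lambda>u. jacobi_matrix lam w (scaled u) n) \<longlongrightarrow> jacobi_matrix lam w L n) (at z)"
    unfolding jacobi_matrix_def by (intro tendsto_intros scaled_tendsto)
  moreover have "((\<lambda>u. jacobi_matrix lam w (scaled u) n) \<longlongrightarrow> z * L n) (at z)"
  proof (rule Lim_transform_eventually)
    show "((\<lambda>u. u * scaled u n) \<longlongrightarrow> z * L n) (at z)" by (intro tendsto_intros scaled_tendsto)
    show "\<forall>\<^sub>F u in at z. u * scaled u n = jacobi_matrix lam w (scaled u) n"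
      using eventually_near by eventually_elim (simp add: scaled_solution)
  qed
  ultimately show ?thesis using tendsto_unique[OF trivial_limit_at] by blast
qed

section \<open>Nonvanishing and square summability at \<open>+\<infinity>\<close>\<close>

lemma FF_from_x_at_top: "((\<lambda>n. FF_from n (x z)) \<longlongrightarrow> 1) at_top"
proof (rule FF_from_at_top[OF summable_majorant _ majorant_nonneg])
  show "cmod (x z k * x z (k + 1)) \<le> majorant k" if "top_z + 1 \<le> k" for k
    unfolding x_mult using that eps by (intro coeff_le_majorant top_z(2)) auto
qed

lemma L_nonzero: "L \<noteq> (\<lambda>n. 0)"
proof
  assume "L = (\<lambda>n. 0)"
  have "\<forall>\<^sub>F n in at_top. FF_from n (x z) \<noteq> 0"
    by (rule tendsto_imp_eventually_ne[OF FF_from_x_at_top]) simp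
  then have "\<forall>\<^sub>F n in at_top. FF_from n (x z) \<noteq> 0 \<and> top_z + 1 \<le> n"
    by (intro eventually_conj eventually_ge_at_top)
  then obtain n where n: "FF_from n (x z) \<noteq> 0" "top_z + 1 \<le> n"
    using eventually_happens'[OF trivial_limit_at_top_linorder] by blast
  then have "L (n - 1) \<noteq> 0" using L_top[of "n - 1"] R_nonzero by simp
  then show False using \<open>L = (\<lambda>n. 0)\<close> by simp
qed

lemma L_summable: "(\<lambda>n. (cmod (L n))\<^sup>2) summable_on {0..}"
proof -
  define n where "n i = top_z + 1 + int i" for i :: nat
  have n: "top_z < n i" "n (Suc i) = n i + 1" "top_z \<le> n i" for i by (auto simp: n_def)
  \<comment> \<open>The weight \<open>cmod (z - lam (n i))\<close> makes the ratio of consecutive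
    terms exactly \<open>cmod (coeff z (n i))\<close>, which tends to \<open>0\<close>. It is
    removed afterwards using its lower bound \<open>\<epsilon>\<close>.\<close>
  define t where "t i = (cmod (R z (n i)))\<^sup>2 * cmod (z - lam (n i))" for i
  have n_top: "filterlim n at_top sequentially"
    unfolding filterlim_at_top
  proof
    fix Z :: int show "\<forall>\<^sub>F i in sequentially. Z \<le> n i"
      using eventually_ge_at_top[of "nat Z"] by eventually_elim (use top_z(1) in \<open>simp add: n_def\<close>)
  qed
  have "(\<lambda>k. cmod (coeff z k)) summable_on range n"
    by (rule summable_on_subset[OF summable_coeff]) (use eps in auto)
  then have "(\<lambda>i. cmod (coeff z (n i))) summable_on UNIV"
    by (subst (asm) summable_on_reindex) (auto simp: inj_on_def o_def n_def)
  then have "(\<lambda>i. cmod (coeff z (n i))) \<longlonglongrightarrow> 0"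
    by (intro summable_LIMSEQ_zero summable_on_imp_summable)
  then have "\<forall>\<^sub>F i in sequentially. cmod (coeff z (n i)) < 1 / 2"
    by (rule order_tendstoD) simp
  then obtain N where N: "\<And>i. N \<le> i \<Longrightarrow> cmod (coeff z (n i)) < 1 / 2"
    by (auto simp: eventually_sequentially)
  have t_Suc: "t (Suc i) = t i * cmod (coeff z (n i))" for i
  proof -
    have "cmod (z - lam (n i)) > 0" "cmod (z - lam (n i + 1)) > 0"
      using top_z(2)[of "n i"] top_z(2)[of "n i + 1"] n(1)[of i] by auto
    then show ?thesis unfolding t_def n(2) R_Suc[OF n(3)] coeff_def
      by (simp add: norm_mult norm_divide norm_power norm_minus_commute[of _ z] power2_eq_square)
  qed
  have t0: "0 \<le> t i" for i by (simp add: t_def)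
  have "summable t"
  proof (rule summable_ratio_test)
    show "norm (t (Suc i)) \<le> 1 / 2 * norm (t i)" if "N \<le> i" for i
      using mult_left_mono[OF less_imp_le[OF N[OF that]] t0[of i]] t0 by (simp add: t_Suc)
  qed simp
  \<comment> \<open>The tails tend to \<open>1\<close>, so \<open>2\<close> eventually bounds them;
    its square is the \<open>4\<close> in the comparison below.\<close>
  have "\<forall>\<^sub>F m in at_top. cmod (FF_from m (x z)) < 2"
    by (rule order_tendstoD[OF tendsto_norm[OF FF_from_x_at_top]]) simp
  then have ev: "\<forall>\<^sub>F i in sequentially. cmod (FF_from (n (Suc i)) (x z)) < 2"
    by (rule eventually_compose_filterlim[OF _ filterlim_compose[OF n_top filterlim_Suc]])
  have "summable (\<lambda>i. (cmod (L (n i)))\<^sup>2)"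
  proof (rule summable_comparison_test_ev)
    show "\<forall>\<^sub>F i in sequentially. norm ((cmod (L (n i)))\<^sup>2) \<le> 4 / \<epsilon> * t i"
      using ev
    proof eventually_elim
      case (elim i)
      have "\<epsilon> \<le> cmod (z - lam (n i))"
        using separated[of "n i"] top_z(2)[OF n(1)] by (simp add: norm_minus_commute)
      then have "(cmod (R z (n i)))\<^sup>2 * \<epsilon> \<le> t i" unfolding t_def by (intro mult_left_mono) auto
      then have 1: "(cmod (R z (n i)))\<^sup>2 \<le> t i / \<epsilon>" using eps by (simp add: field_simps)
      have "(cmod (FF_from (n (Suc i)) (x z)))\<^sup>2 \<le> 2\<^sup>2" using elim by (intro power_mono) auto
      then have "(cmod (R z (n i)))\<^sup>2 * (cmod (FF_from (n (Suc i)) (x z)))\<^sup>2 \<le> t i / \<epsilon> * 4"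
        using t0[of i] eps by (intro mult_mono 1) auto
      then show ?case unfolding L_top[OF n(3)] n(2) by (simp add: norm_mult power_mult_distrib mult.commute)
    qed
    show "summable (\<lambda>i. 4 / \<epsilon> * t i)" by (rule summable_mult) fact
  qed
  then have "(\<lambda>i. (cmod (L (n i)))\<^sup>2) summable_on UNIV"
    by (rule summable_nonneg_imp_summable_on) simp
  also have "?this \<longleftrightarrow> (\<lambda>k. (cmod (L k))\<^sup>2) summable_on {top_z + 1..}"
    by (rule summable_on_reindex_bij_witness[of _ "\<lambda>k. nat (k - (top_z + 1))" n]) (auto simp: n_def)
  finally have "(\<lambda>k. (cmod (L k))\<^sup>2) summable_on ({0..top_z} \<union> {top_z + 1..})"
    by (rule summable_on_union[OF summable_on_finite[OF finite_atLeastAtMost_int]])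
  then show ?thesis by (rule summable_on_subset) auto
qed

text \<open>Here nothing is rescaled, so the two sequences agree from \<open>top_z\<close> on by the
  explicit formula; being solutions of the same recurrence, they agree everywhere.\<close>

lemma L_eq_f:
  assumes "\<And>k. lam k \<noteq> z"
  shows "L n = f z n"
proof -
  have eq: "L k = f z k" if "top_z \<le> k" for k
    using that top_z(1) assms by (simp add: L_top f_eq R_def PP_def)
  have "1 * L n - 1 * f z n = 0"
  proof (rule jacobi_solution_eq_zero[OF w_nonzero, of lam "\<lambda>n. 1 * L n - 1 * f z n" z top_z])
    show "jacobi_matrix lam w (\<lambda>n. 1 * L n - 1 * f z n) n = z * (1 * L n - 1 * f z n)" for n
      unfolding jacobi_matrix_lincomb L_solution
      using f_solution[of z n] assms eps by (simp add: algebra_simps)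
  qed (simp_all add: eq)
  then show ?thesis by simp
qed

lemma f_seq_eq_L: "f_seq lam w \<gamma> z = L"
proof
  fix n
  show "f_seq lam w \<gamma> z n = L n"
  proof (cases "z \<in> C0 lam")
    case True
    then have "lam k \<noteq> z" for k unfolding C0_def using closure_subset[of "range lam"] by auto
    then show ?thesis using True by (simp add: f_seq_def L_eq_f)
  qed (simp add: f_seq_def L_def scaled_def)
qed

section \<open>Reflection and the Wronskian\<close>

lemma reflected: "jacobi_point (\<lambda>n. lam (- n)) (\<lambda>n. w (- n - 1)) (\<lambda>n. \<gamma> (- n)) z z0 \<epsilon>"
proof
  show "\<forall>n. \<gamma> (- n) * \<gamma> (- (n + 1)) = w (- n - 1)"
    using gamma by (metis diff_add_cancel minus_add_distrib mult.commute uminus_add_conv_diff diff_conv_add_uminus)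
  show "(\<lambda>n. cmod ((w (- n - 1))\<^sup>2 / ((lam (- n) - z0) * (lam (- (n + 1)) - z0)))) summable_on UNIV"
    by (rule iffD1[OF summable_on_reindex_bij_witness[of UNIV "\<lambda>k. - k - 1" "\<lambda>k. - k - 1"] summable_z0])
       (auto simp: mult.commute add.commute)
  have "{n. lam (- n) = z} = uminus ` {n. lam n = z}" by force
  then show "finite {n. lam (- n) = z}" using finite_z by simp
qed (use w_nonzero z0 eps separated in auto)

text \<open>Read at \<open>-n\<close>, the mirrored solution solves the original equation and is
  square summable at \<open>-\<infinity>\<close>.\<close>

interpretation mirror: jacobi_point "\<lambda>n. lam (- n)" "\<lambda>n. w (- n - 1)" "\<lambda>n. \<gamma> (- n)" z z0 \<epsilon>
  by (rule reflected)

text \<open>This is \<open>FF_split\<close> at index \<open>0\<close> with the four explicit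
  \<open>PP\<close> factors inserted. The mirrored solution appears at \<open>0\<close> and
  \<open>- 1\<close> because these stand for the original indices \<open>0\<close> and
  \<open>1\<close>.\<close>

lemma wronskian_eq_char_fun:
  assumes "cmod (u - z) \<le> \<epsilon> / 2" "u \<noteq> z"
  shows "w 0 * (f u 1 * mirror.f u 0 - f u 0 * mirror.f u (- 1)) = (lam 0 - u) * char_fun lam \<gamma> u"
proof -
  define p where "p = u - lam 0"
  define q where "q = u - lam 1"
  have pq: "lam 0 - u = - p" "lam 1 - u = - q" by (simp_all add: p_def q_def)
  have nz: "p \<noteq> 0" "q \<noteq> 0"
    using lam_neq_near[OF assms, of 0] lam_neq_near[OF assms, of 1] by (auto simp: p_def q_def)
  have mirror_x: "mirror.x u = (\<lambda>k. x u (- k))" by (simp add: mirror.x_def x_def fun_eq_iff)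
  have "(\<lambda>k. cmod (x u k * x u (k + 1))) summable_on UNIV"
    unfolding x_mult by (rule summable_coeff[OF assms(1)])
  from FF_split[OF this, of 0]
  have "FF (x u) = FF_from 0 (mirror.x u) * FF_from 1 (x u)
      - coeff u 0 * FF_from 1 (mirror.x u) * FF_from 2 (x u)"
    using x_mult[of u 0] by (simp add: mirror_x)
  moreover have "char_fun lam \<gamma> u = FF (x u)"
    unfolding char_fun_def x_def
    by (rule FF_cong) (metis (no_types, lifting) minus_diff_eq minus_divide_right minus_mult_minus)
  moreover have "PP lam w u 1 = w 0 / (u - lam 1)" "PP lam w u 0 = 1"
    "PP (\<lambda>n. lam (- n)) (\<lambda>n. w (- n - 1)) u 0 = 1"
    "PP (\<lambda>n. lam (- n)) (\<lambda>n. w (- n - 1)) u (- 1) = (u - lam 0) / w 0"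
    by (simp_all add: PP_def)
  ultimately show ?thesis
    using nz w_nonzero
    by (simp add: f_eq mirror.f_eq coeff_def pq flip: p_def q_def)
       (simp add: field_simps power2_eq_square)
qed

text \<open>Reflection turns positive indices into negative ones, so the two rescaling exponents
  together account for every occurrence of \<open>z\<close> except one at index
  \<open>0\<close>.\<close>

lemma r_all_eq:
  "r_all lam z = r_plus lam z + r_plus (\<lambda>n. lam (- n)) z + (if lam 0 = z then 1 else 0)"
proof -
  define P where "P = {n. n > 0 \<and> lam n = z}"
  define M where "M = uminus ` {n. n > 0 \<and> lam (- n) = z}"
  define Z where "Z = (if lam 0 = z then {0::int} else {})"
  have M: "M = {n. n < 0 \<and> lam n = z}" unfolding M_def by (auto intro: image_eqI[of _ _ "- n" for n])
  have fin: "finite P" "finite M" "finite Z"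
    unfolding P_def M Z_def using finite_z by (auto elim: finite_subset[rotated])
  have "{n. lam n = z} = (P \<union> M) \<union> Z"
    unfolding P_def M Z_def by (auto, (metis linorder_neqE_linordered_idom)+)
  moreover have "card ((P \<union> M) \<union> Z) = card P + card M + card Z"
    using fin by (subst card_Un_disjoint | auto simp: P_def M Z_def)+
  moreover have "card M = r_plus (\<lambda>n. lam (- n)) z"
    unfolding M_def r_plus_def by (rule card_image) auto
  ultimately show ?thesis by (simp add: r_all_def r_plus_def P_def Z_def)
qed

lemma eigenvector_L:
  assumes lim: "((\<lambda>u. (u - z) ^ r_all lam z * char_fun lam \<gamma> u) \<longlongrightarrow> 0) (at z)"
  shows "eigenvector (Jmax_dom lam w) (jacobi_matrix lam w) z L"
proof -
  define G where "G n = mirror.L (- n)" for n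
  have G_sol: "jacobi_matrix lam w G n = z * G n" for n
    using mirror.L_solution[of "- n"] by (simp add: jacobi_matrix_reflect G_def[abs_def])
  have G_nonzero: "G \<noteq> (\<lambda>n. 0)"
  proof
    assume "G = (\<lambda>n. 0)"
    then have "mirror.L n = 0" for n unfolding G_def by (metis minus_minus)
    then show False using mirror.L_nonzero by blast
  qed
  define W where "W u = w 0 * (scaled u 1 * mirror.scaled u 0 - scaled u 0 * mirror.scaled u (- 1))" for u
  \<comment> \<open>Neither \<open>r_plus\<close> counts the index \<open>0\<close>; if \<open>lam 0 = z\<close>, the missing power of \<open>u - z\<close> comes from
    the factor \<open>lam 0 - u\<close> of the Wronskian.\<close>
  define c where "c u = (if lam 0 = z then - 1 else lam 0 - u)" for u
  have "(W \<longlongrightarrow> w 0 * (L 1 * G 0 - L 0 * G 1)) (at z)"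
    unfolding W_def G_def using scaled_tendsto mirror.scaled_tendsto by (auto intro!: tendsto_intros)
  moreover have "(W \<longlongrightarrow> c z * 0) (at z)"
  proof (rule Lim_transform_eventually)
    have "(c \<longlongrightarrow> c z) (at z)" unfolding c_def by (auto intro!: tendsto_intros)
    then show "((\<lambda>u. c u * ((u - z) ^ r_all lam z * char_fun lam \<gamma> u)) \<longlongrightarrow> c z * 0) (at z)"
      by (rule tendsto_mult[OF _ lim])
    show "\<forall>\<^sub>F u in at z. c u * ((u - z) ^ r_all lam z * char_fun lam \<gamma> u) = W u"
      using eventually_near
    proof eventually_elim
      case (elim u)
      have "W u = (u - z) ^ (r_plus lam z + r_plus (\<lambda>n. lam (- n)) z)
          * (w 0 * (f u 1 * mirror.f u 0 - f u 0 * mirror.f u (- 1)))"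
        by (simp add: W_def scaled_def mirror.scaled_def power_add algebra_simps)
      also have "\<dots> = (u - z) ^ (r_plus lam z + r_plus (\<lambda>n. lam (- n)) z)
          * ((lam 0 - u) * char_fun lam \<gamma> u)"
        using elim by (simp add: wronskian_eq_char_fun)
      also have "\<dots> = c u * ((u - z) ^ r_all lam z * char_fun lam \<gamma> u)"
        by (simp add: r_all_eq c_def algebra_simps)
      finally show ?case ..
    qed
  qed
  ultimately have "w 0 * (L 1 * G 0 - L 0 * G 1) = c z * 0"
    using tendsto_unique[OF trivial_limit_at] by blast
  then have "L (0 + 1) * G 0 = L 0 * G (0 + 1)" using w_nonzero by simp
  from jacobi_solutions_proportional[OF w_nonzero L_solution G_sol this G_nonzero]
  obtain q where q: "L n = q * G n" for n by blast
  \<comment> \<open>Proportionality passes the decay of \<open>G\<close> at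
    \<open>-\<infinity>\<close> on to \<open>L\<close>, whose decay at \<open>+\<infinity>\<close>
    is already known.\<close>
  have "(\<lambda>n. (cmod (G n))\<^sup>2) summable_on {..0}"
    by (rule iffD1[OF summable_on_reindex_bij_witness[of "{0..}" uminus uminus] mirror.L_summable])
       (auto simp: G_def)
  then have "(\<lambda>n. (cmod q)\<^sup>2 * (cmod (G n))\<^sup>2) summable_on {..0}"
    by (rule summable_on_cmult_right)
  then have "(\<lambda>n. (cmod (L n))\<^sup>2) summable_on {..0}"
    by (simp add: q norm_mult power_mult_distrib)
  from summable_on_union[OF this L_summable]
  have sm: "(\<lambda>n. (cmod (L n))\<^sup>2) summable_on UNIV"
    by (rule summable_on_subset) auto
  have J: "jacobi_matrix lam w L = (\<lambda>n. z * L n)" by (rule ext) (rule L_solution)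
  have "(\<lambda>n. (cmod z)\<^sup>2 * (cmod (L n))\<^sup>2) summable_on UNIV"
    by (rule summable_on_cmult_right[OF sm])
  then have "(\<lambda>n. z * L n) \<in> ell2" by (simp add: ell2_def norm_mult power_mult_distrib)
  then show ?thesis
    using sm L_nonzero by (simp add: eigenvector_def Jmax_dom_def ell2_def J)
qed

end

section \<open>Eigenvectors on the extended zero set\<close>

theorem proposition11:
  fixes lam w \<gamma> :: "int \<Rightarrow> complex"
  assumes w_nonzero: "\<forall>n. w n \<noteq> 0"
    and summability: "\<exists>z0 \<in> C0 lam.
      (\<lambda>n. cmod ((w n)\<^sup>2 / ((lam n - z0) * (lam (n + 1) - z0)))) summable_on UNIV"
    and gamma: "\<forall>n. \<gamma> n * \<gamma> (n + 1) = w n"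
  shows "zero_set lam \<gamma> \<subseteq> point_spectrum (Jmax_dom lam w) (jacobi_matrix lam w) - der lam \<and>
    (\<forall>z \<in> zero_set lam \<gamma>.
       eigenvector (Jmax_dom lam w) (jacobi_matrix lam w) z (f_seq lam w \<gamma> z))"
proof -
  have "z \<notin> der lam \<and> eigenvector (Jmax_dom lam w) (jacobi_matrix lam w) z (f_seq lam w \<gamma> z)"
    if "z \<in> zero_set lam \<gamma>" for z
  proof -
    have z: "z \<notin> der lam" "((\<lambda>u. (u - z) ^ r_all lam z * char_fun lam \<gamma> u) \<longlongrightarrow> 0) (at z)"
      using that by (auto simp: zero_set_def)
    obtain z0 where z0: "z0 \<in> C0 lam"
      "(\<lambda>n. cmod ((w n)\<^sup>2 / ((lam n - z0) * (lam (n + 1) - z0)))) summable_on UNIV"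
      using summability by blast
    obtain \<epsilon> where eps: "\<epsilon> > 0" "finite {n. lam n = z}" "\<And>n. lam n \<noteq> z \<Longrightarrow> \<epsilon> \<le> cmod (lam n - z)"
      using not_der_isolated[OF z(1)] by blast
    interpret jacobi_point lam w \<gamma> z z0 \<epsilon>
    proof
      show "lam n \<noteq> z0" for n
        using z0(1) closure_subset[of "range lam"] unfolding C0_def by auto
    qed (use w_nonzero gamma z0(2) eps in auto)
    show ?thesis using z(1) eigenvector_L[OF z(2)] by (simp add: f_seq_eq_L)
  qed
  then show ?thesis by (auto simp: point_spectrum_def)
qed

end
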